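(* Suppose $\nabla f$ is locally Lipschitz continuous on $\mathbb{N}$. Let $\{(\mathbf{w}^k,\mathbf{x}^k,\mathbf{y}^k;\mu_k)\}$ be the sequence generated by the ShaPeak algorithm with $\mathbf{Q}^k\succeq\mathbf{0}$, $\|\mathbf{Q}^k\|\leq\lambda$ for all $k$, and $\sigma\geq 8\max\{\lambda,\beta\}$. Suppose that $\mu_0>\overline{\mu}$. Let $\mathbf{x}^\infty$ denote the limit of $\{\mathbf{x}^k\}$ (which exists under these hypotheses). Then there is an integer $\kappa>0$ such that for any $k\geq\kappa$, $$\mathbf{w}^{k+1}=\mathbf{w}^k=\mathbf{x}^\infty\in\{0,1\}^n,\qquad \|\mathbf{x}^k-\mathbf{x}^\infty\|\leq\sqrt{\alpha}\,\gamma^{k-\kappa},\qquad \|\mathbf{y}^k+\nabla f(\mathbf{x}^\infty)\|\leq\sqrt{\alpha}\,\lambda\,\gamma^{k-\kappa},$$ where $\gamma:=\lambda/(\sigma-\lambda)\in(0,1/7]$. Consequently, after $$\kappa+\left\lceil\log_\gamma\left(\frac{\varepsilon}{\max\{1,\lambda\}\sqrt{\alpha}}\right)\right\rceil$$ iterations, the stopping conditions $$\mathbf{w}^k\in\{0,1\}^n,\qquad \max\left\{\frac{\|\mathbf{x}^k-\mathbf{w}^k\|}{1+\|\mathbf{w}^k\|},\ \frac{\|\mathbf{y}^k+\nabla f(\mathbf{w}^k)\|}{1+\|\mathbf{w}^k\|}\right\}<\varepsilon$$ can be satisfied, where $\varepsilon\in(0,1)$ is the given tolerance.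
   Context: Setting. $f:\mathbb{R}^n\to\mathbb{R}\cup\{\infty\}$ is continuously differentiable; $B=[0,1]$, $\mathbb{B}=[0,1]^n$. $\|\cdot\|$ is the Euclidean norm of vectors and spectral norm of symmetric matrices; $\lceil a\rceil$ is the ceiling of $a$. $\partial$ is the limiting subdifferential (Rockafellar–Wets, Definition 8.3), $N_B$ the normal cone of $B$, $\delta_B$ the indicator function of $B$. A function $g:\mathbb{R}\to\mathbb{R}\cup\{\infty\}$ is a sharp-peak function (SPF) if (c1) for any $x\in B$, $g(x)\geq 0$, and $g(x)=0$ iff $x\in\{0,1\}$; (c2) $g$ is lower semi-continuous on $B$ and there is $c>0$ with $|\nu|\geq c$ for all $\nu\in\partial g(x)$, $x\in B$; (c3) $\partial(g+\delta_B)(x)=\partial g(x)+N_B(x)$ for $x\in\{0,1\}$. Fix an SPF $g$ with constant $c$, and set $\varphi(\mathbf{x})=\sum_{i=1}^n g(x_i)$ and $\overline{\mu}=\max_{\mathbf{x}\in\mathbb{B}}\|\nabla f(\mathbf{x})\|_\infty/c$. ShaPeak algorithm (stopping test ignored, so the sequence is infinite). Parameters: $\mu_0,\sigma>0$, $\eta>1$, $\rho\in(0,1/6]$, $\epsilon>0$, an integer $k_0>0$, symmetric matrices $\mathbf{Q}^k$. Initialize $\mathbf{w}^0=\mathbf{x}^0\in\{0,1\}^n$, $\mathbf{y}^0=-\nabla f(\mathbf{w}^0)$. For $k=0,1,2,\dots$: $$\mathbf{w}^{k+1}\in\operatorname{argmin}_{\mathbf{w}\in\mathbb{B}}\ \mu_k\varphi(\mathbf{w})+\langle\mathbf{y}^k,\mathbf{x}^k-\mathbf{w}\rangle+\tfrac{\sigma}{2}\|\mathbf{x}^k-\mathbf{w}\|^2,$$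 $$\mathbf{x}^{k+1}=\mathbf{w}^{k+1}-(\sigma\mathbf{I}+\mathbf{Q}^{k+1})^{-1}(\nabla f(\mathbf{w}^{k+1})+\mathbf{y}^k),\qquad \mathbf{y}^{k+1}=\mathbf{y}^k+\sigma(\mathbf{x}^{k+1}-\mathbf{w}^{k+1}),$$ and, for each $k\geq1$, $\mu_k=\mu_{k-1}+\min\{(\eta-1)\mu_{k-1},\ \rho\sigma\|\mathbf{x}^k-\mathbf{w}^k\|^2/(\varphi(\mathbf{w}^k)+\epsilon)\}$ if $k_0$ divides $k$ and $\varphi(\mathbf{w}^k)\neq0$, and $\mu_k=\mu_{k-1}$ otherwise. Further notation. Let $f_B=\min_{\mathbf{w}\in\mathbb{B}}f(\mathbf{w})$, $\alpha=(2f(\mathbf{w}^0)-2f_B)/\sigma$, and $\mathbb{N}=\{\mathbf{x}\in\mathbb{R}^n:\|\mathbf{x}\|_\infty\leq 1+(\sqrt{n}+\sqrt{\alpha})/8\}$. $\lambda>0$ is a predefined constant, and $\beta\in(0,\infty)$ is a Lipschitz constant of $\nabla f$ on $\mathbb{N}$ (it exists since $\nabla f$ is locally Lipschitz on the compact set $\mathbb{N}$). A map is locally Lipschitz on a set if every point of the set has a neighbourhood on which it is Lipschitz. *)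

theory Defs
  imports "HOL-Analysis.Analysis"
begin

section \<open>Variational analysis\<close>

text \<open>
  Functions with values in \<open>\<real> \<union> {\<infinity>}\<close> have type \<open>'a \<Rightarrow> ereal\<close>, with the value \<open>-\<infinity>\<close> excluded
  where it matters. Subgradients follow Rockafellar and Wets, Definition 8.3; they exist only at
  points where the function is finite.
\<close>

text \<open>
  The \<open>Liminf\<close> condition is the meaning of
  \<open>f u \<ge> f x + \<langle>v, u - x\<rangle> + o(\<parallel>u - x\<parallel>)\<close>.
\<close>

definition regular_subdifferential :: "('a::euclidean_space \<Rightarrow> ereal) \<Rightarrow> 'a \<Rightarrow> 'a set" where
  "regular_subdifferential f x =
     {v. \<bar>f x\<bar> \<noteq> \<infinity> \<and>
         Liminf (at x) (\<lambda>u. (f u - f x - ereal (v \<bullet> (u - x))) / ereal (norm (u - x))) \<ge> 0}"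

definition limiting_subdifferential :: "('a::euclidean_space \<Rightarrow> ereal) \<Rightarrow> 'a \<Rightarrow> 'a set" where
  "limiting_subdifferential f x =
     {v. \<bar>f x\<bar> \<noteq> \<infinity> \<and>
         (\<exists>xs vs. xs \<longlonglongrightarrow> x \<and> (\<lambda>j. f (xs j)) \<longlonglongrightarrow> f x \<and>
                  (\<forall>j. vs j \<in> regular_subdifferential f (xs j)) \<and> vs \<longlonglongrightarrow> v)}"

text \<open>The normal cone of convex analysis; it is only used for the convex set \<open>[0,1]\<close>.\<close>

definition normal_cone :: "'a::euclidean_space set \<Rightarrow> 'a \<Rightarrow> 'a set" where
  "normal_cone C x = {v. x \<in> C \<and> (\<forall>u\<in>C. v \<bullet> (u - x) \<le> 0)}"

definition indicator_ext :: "'a set \<Rightarrow> 'a \<Rightarrow> ereal" where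
  "indicator_ext C x = (if x \<in> C then 0 else \<infinity>)"

text \<open>
  Lower semicontinuity on \<open>C\<close> is taken relative to \<open>C\<close>, as in \<^const>\<open>continuous_on\<close>.
\<close>

definition lsc_on :: "'a::topological_space set \<Rightarrow> ('a \<Rightarrow> ereal) \<Rightarrow> bool" where
  "lsc_on C f \<longleftrightarrow> (\<forall>x\<in>C. f x \<le> Liminf (at x within C) f)"

text \<open>An extended-valued function is differentiable at \<open>x\<close> only if it is finite near \<open>x\<close>.\<close>

definition has_gradient_ext ::
    "('a::euclidean_space \<Rightarrow> ereal) \<Rightarrow> 'a \<Rightarrow> 'a \<Rightarrow> bool" where
  "has_gradient_ext f x d \<longleftrightarrow>
     (\<forall>\<^sub>F u in nhds x. \<bar>f u\<bar> \<noteq> \<infinity>) \<and> GDERIV (\<lambda>u. real_of_ereal (f u)) x :> d"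

definition continuously_differentiable_ext ::
    "('a::euclidean_space \<Rightarrow> ereal) \<Rightarrow> ('a \<Rightarrow> 'a) \<Rightarrow> bool" where
  "continuously_differentiable_ext f grad \<longleftrightarrow>
     (\<forall>x. has_gradient_ext f x (grad x)) \<and> continuous_on UNIV grad"

definition locally_lipschitz_on ::
    "'a::metric_space set \<Rightarrow> ('a \<Rightarrow> 'b::metric_space) \<Rightarrow> bool" where
  "locally_lipschitz_on C F \<longleftrightarrow>
     (\<forall>x\<in>C. \<exists>U L. open U \<and> x \<in> U \<and> L-lipschitz_on U F)"


section \<open>Sharp-peak functions\<close>

definition sharp_peak :: "(real \<Rightarrow> ereal) \<Rightarrow> real \<Rightarrow> bool" where
  "sharp_peak g c \<longleftrightarrow>
     (\<forall>x. g x \<noteq> -\<infinity>) \<and>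
     (\<forall>x\<in>{0..1}. g x \<ge> 0 \<and> (g x = 0 \<longleftrightarrow> x \<in> {0, 1})) \<and>
     lsc_on {0..1} g \<and>
     c > 0 \<and> (\<forall>x\<in>{0..1}. \<forall>\<nu>\<in>limiting_subdifferential g x. \<bar>\<nu>\<bar> \<ge> c) \<and>
     (\<forall>x\<in>{0, 1}. limiting_subdifferential (\<lambda>u. g u + indicator_ext {0..1} u) x =
                  {a + b | a b. a \<in> limiting_subdifferential g x \<and> b \<in> normal_cone {0..1} x})"

definition penalty :: "(real \<Rightarrow> ereal) \<Rightarrow> real^'n \<Rightarrow> ereal" where
  "penalty g x = (\<Sum>i\<in>UNIV. g (x $ i))"

definition unit_cube :: "(real^'n) set" where
  "unit_cube = {x. \<forall>i. x $ i \<in> {0..1}}"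

definition binary_points :: "(real^'n) set" where
  "binary_points = {x. \<forall>i. x $ i \<in> {0, 1}}"

text \<open>The supremum is a maximum when \<open>grad\<close> is continuous.\<close>

definition mu_bar :: "(real^'n \<Rightarrow> real^'n) \<Rightarrow> real \<Rightarrow> real" where
  "mu_bar grad c = (SUP x\<in>unit_cube. infnorm (grad x)) / c"


section \<open>The ShaPeak algorithm\<close>

definition symmetric_matrix :: "real^'n^'n \<Rightarrow> bool" where
  "symmetric_matrix A \<longleftrightarrow> transpose A = A"

definition psd_matrix :: "real^'n^'n \<Rightarrow> bool" where
  "psd_matrix A \<longleftrightarrow> symmetric_matrix A \<and> (\<forall>v. v \<bullet> (A *v v) \<ge> 0)"

definition subproblem_objective ::
    "(real \<Rightarrow> ereal) \<Rightarrow> real \<Rightarrow> real \<Rightarrow> real^'n \<Rightarrow> real^'n \<Rightarrow> real^'n \<Rightarrow> ereal" where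
  "subproblem_objective g \<sigma> m xk yk u =
     ereal m * penalty g u + ereal (yk \<bullet> (xk - u) + \<sigma> / 2 * (norm (xk - u))\<^sup>2)"

text \<open>
  The infinite sequences produced by the algorithm without a stopping test. Only the matrices
  \<open>Q 1, Q 2, \<dots>\<close> are used. For \<open>k \<ge> 1\<close> the value \<open>penalty g (w k)\<close> is finite because \<open>w k\<close>
  minimises an objective that is finite at the points of \<open>{0,1}\<^sup>n\<close>, so \<^const>\<open>real_of_ereal\<close>
  loses nothing.
\<close>

definition shapeak_sequence ::
    "(real^'n \<Rightarrow> real^'n) \<Rightarrow> (real \<Rightarrow> ereal) \<Rightarrow>
     real \<Rightarrow> real \<Rightarrow> real \<Rightarrow> real \<Rightarrow> nat \<Rightarrow> (nat \<Rightarrow> real^'n^'n) \<Rightarrow>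
     (nat \<Rightarrow> real^'n) \<Rightarrow> (nat \<Rightarrow> real^'n) \<Rightarrow> (nat \<Rightarrow> real^'n) \<Rightarrow> (nat \<Rightarrow> real) \<Rightarrow> bool" where
  "shapeak_sequence grad g \<sigma> \<eta> \<rho> \<epsilon> k0 Q w x y \<mu> \<longleftrightarrow>
     w 0 = x 0 \<and> x 0 \<in> binary_points \<and> y 0 = - grad (w 0) \<and>
     (\<forall>k. is_arg_min (subproblem_objective g \<sigma> (\<mu> k) (x k) (y k)) (\<lambda>u. u \<in> unit_cube) (w (Suc k))) \<and>
     (\<forall>k. x (Suc k) = w (Suc k) -
            matrix_inv (\<sigma> *\<^sub>R mat 1 + Q (Suc k)) *v (grad (w (Suc k)) + y k)) \<and>
     (\<forall>k. y (Suc k) = y k + \<sigma> *\<^sub>R (x (Suc k) - w (Suc k))) \<and>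
     (\<forall>k\<ge>1. \<mu> k =
        (if k0 dvd k \<and> penalty g (w k) \<noteq> 0
         then \<mu> (k - 1) + min ((\<eta> - 1) * \<mu> (k - 1))
                (\<rho> * \<sigma> * (norm (x k - w k))\<^sup>2 / (real_of_ereal (penalty g (w k)) + \<epsilon>))
         else \<mu> (k - 1)))"

definition alpha :: "(real^'n \<Rightarrow> ereal) \<Rightarrow> real^'n \<Rightarrow> real \<Rightarrow> real" where
  "alpha f w0 \<sigma> =
     (2 * real_of_ereal (f w0) - 2 * real_of_ereal (INF u\<in>unit_cube. f u)) / \<sigma>"

definition region :: "real \<Rightarrow> (real^'n) set" where
  "region a = {x. infnorm x \<le> 1 + (sqrt (real CARD('n)) + sqrt a) / 8}"

definition stopping_test :: "(real^'n \<Rightarrow> real^'n) \<Rightarrow> real \<Rightarrow> real^'n \<Rightarrow> real^'n \<Rightarrow> real^'n \<Rightarrow> bool" where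
  "stopping_test grad tol wk xk yk \<longleftrightarrow>
     wk \<in> binary_points \<and>
     max (norm (xk - wk) / (1 + norm wk)) (norm (yk + grad wk) / (1 + norm wk)) < tol"

end

theory Submission
  imports Defs
begin

text \<open>
  Put \<open>d\<^sub>k = x\<^sub>k - w\<^sub>k\<close>. Combining the updates of \<open>x\<close> and \<open>y\<close> gives
  \<open>y\<^sub>k = - grad (w\<^sub>k) - Q\<^sub>k d\<^sub>k\<close> (lemma \<open>y_eq\<close>), so the multiplier is determined by the other two
  sequences up to an error of size \<open>lam \<parallel>d\<^sub>k\<parallel>\<close>. Subtracting two consecutive such identities bounds the
  new gap by the old gap and the step of \<open>w\<close>:
  \<open>\<sigma> \<parallel>d\<^sub>k\<^sub>+\<^sub>1\<parallel> \<le> \<beta> \<parallel>w\<^sub>k\<^sub>+\<^sub>1 - w\<^sub>k\<parallel> + lam \<parallel>d\<^sub>k\<parallel>\<close> (lemma \<open>gap_Suc_le\<close>). Everything rests on this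
  recursion.

  The penalty is not convex, so minimality of \<open>w\<^sub>k\<^sub>+\<^sub>1\<close> by itself yields no decrease proportional to
  the step of \<open>w\<close>. The decrease comes from the \<open>x\<close>-update, in which \<open>\<sigma>\<close> dominates the curvature of
  the objective. Adding \<open>\<sigma> \<parallel>d\<^sub>k\<parallel>\<^sup>2\<close> to the augmented Lagrangian gives an energy for which this decrease
  pays for the increases caused by the multiplier and penalty updates: it drops by at least
  \<open>\<sigma>/8 \<parallel>x\<^sub>k\<^sub>+\<^sub>1 - x\<^sub>k\<parallel>\<^sup>2 + \<sigma>/2 \<parallel>d\<^sub>k\<parallel>\<^sup>2\<close> (lemma \<open>energy_descent\<close>). The energy also dominates
  \<open>fB + \<sigma> \<parallel>d\<^sub>k\<parallel>\<^sup>2\<close>, where \<open>fB\<close> bounds the objective from below on the cube. An induction therefore keeps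
  \<open>\<parallel>d\<^sub>k\<parallel> \<le> sqrt \<alpha>\<close> and keeps the iterates where the gradient is \<open>\<beta>\<close>-Lipschitz (lemma
  \<open>iterates_stay\<close>), and the drops are summable, so \<open>d\<^sub>k\<close> and \<open>w\<^sub>k\<^sub>+\<^sub>1 - w\<^sub>k\<close> tend to \<open>0\<close>.

  If a coordinate of \<open>w\<^sub>k\<^sub>+\<^sub>1\<close> lay strictly between \<open>0\<close> and \<open>1\<close>, Fermat's rule and the sharpness of the
  penalty would force the corresponding coordinate of \<open>y\<^sub>k + \<sigma> (x\<^sub>k - w\<^sub>k\<^sub>+\<^sub>1)\<close> to have absolute value at
  least \<open>\<mu>\<^sub>k c \<ge> \<mu>\<^sub>0 c\<close>. In the limit that vector differs from \<open>- grad (w\<^sub>k)\<close> by a vanishing amount, and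
  the components of the gradient are at most \<open>mu_bar grad c * c < \<mu>\<^sub>0 c\<close>. Hence \<open>w\<^sub>k\<close> is eventually
  binary, and as its steps vanish it is eventually constant. From then on the recursion
  reads \<open>\<parallel>d\<^sub>k\<^sub>+\<^sub>1\<parallel> \<le> \<gamma> \<parallel>d\<^sub>k\<parallel>\<close>, which gives the geometric rates.
\<close>

section \<open>Smooth functions and positive semidefinite shifts\<close>

text \<open>
  The sharp constant is \<open>\<beta> / 2\<close>; the mean value theorem gives \<open>\<beta>\<close>, and the estimates below have
  room for it.
\<close>

lemma gradient_lower_bound:
  fixes F :: "'a::euclidean_space \<Rightarrow> real"
  assumes F: "\<And>u. GDERIV F u :> G u"
    and S: "convex S" "a \<in> S" "b \<in> S"
    and lip: "\<beta>-lipschitz_on S G"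
  shows "F a + G a \<bullet> (b - a) - \<beta> * (norm (b - a))\<^sup>2 \<le> F b"
proof -
  define p where "p t = a + t *\<^sub>R (b - a)" for t :: real
  have der: "((\<lambda>t. F (p t)) has_real_derivative G (p t) \<bullet> (b - a)) (at t)" for t
  proof -
    have 1: "(p has_derivative (\<lambda>h. h *\<^sub>R (b - a))) (at t)"
      unfolding p_def by (auto intro!: derivative_eq_intros)
    have 2: "(F has_derivative (\<lambda>h. h \<bullet> G (p t))) (at (p t))"
      using F[of "p t"] by (simp add: gderiv_def)
    have "((\<lambda>t. F (p t)) has_derivative (\<lambda>h. (h *\<^sub>R (b - a)) \<bullet> G (p t))) (at t)"
      using has_derivative_compose[OF 1 2] .
    then show ?thesis
      by (simp add: has_field_derivative_def inner_commute mult.commute[of _ "G (p t) \<bullet> (b - a)"]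
          fun_eq_iff)
  qed
  obtain z where z: "0 < z" "z < 1" "F (p 1) - F (p 0) = (1 - 0) * (G (p z) \<bullet> (b - a))"
    using MVT2[of 0 1 "\<lambda>t. F (p t)" "\<lambda>t. G (p t) \<bullet> (b - a)"] der by auto
  have pz: "p z \<in> S"
  proof -
    have "p z = (1 - z) *\<^sub>R a + z *\<^sub>R b" by (simp add: p_def algebra_simps)
    then show ?thesis using S z by (auto intro: convexD_alt)
  qed
  have \<beta>: "\<beta> \<ge> 0" using lip by (rule lipschitz_on_nonneg)
  have "norm (G (p z) - G a) \<le> \<beta> * norm (p z - a)"
    using lipschitz_onD[OF lip pz S(2)] by (simp add: dist_norm)
  also have "norm (p z - a) = z * norm (b - a)" using z by (simp add: p_def)
  also have "\<beta> * (z * norm (b - a)) \<le> \<beta> * norm (b - a)"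
    using z \<beta> by (intro mult_left_mono) (auto intro: mult_left_le_one_le)
  finally have n: "norm (G (p z) - G a) \<le> \<beta> * norm (b - a)" .
  have "\<bar>(G (p z) - G a) \<bullet> (b - a)\<bar> \<le> norm (G (p z) - G a) * norm (b - a)"
    by (rule Cauchy_Schwarz_ineq2)
  also have "\<dots> \<le> \<beta> * norm (b - a) * norm (b - a)"
    using n by (rule mult_right_mono) simp
  finally have "- (\<beta> * (norm (b - a))\<^sup>2) \<le> (G (p z) - G a) \<bullet> (b - a)"
    by (simp add: power2_eq_square mult.assoc)
  moreover have "F b - F a = G (p z) \<bullet> (b - a)" using z by (simp add: p_def)
  ultimately show ?thesis by (simp add: inner_diff_left)
qed

text \<open>
  Pairing with \<open>v\<close> itself, the semidefinite part only helps. This keeps the constant \<open>s\<close> free of any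
  loss in the norm of \<open>A\<close>.
\<close>

lemma psd_shift_norm_ge:
  fixes A :: "real^'n^'n"
  assumes "psd_matrix A"
  shows "s * norm v \<le> norm ((s *\<^sub>R mat 1 + A) *v v)"
proof (cases "v = 0")
  case False
  have eq: "(s *\<^sub>R mat 1 + A) *v v = s *\<^sub>R v + A *v v"
    by (simp add: matrix_vector_mult_add_rdistrib scaleR_matrix_vector_assoc[symmetric])
  have "s * norm v * norm v = s * (v \<bullet> v)"
    by (simp add: power2_norm_eq_inner[symmetric] power2_eq_square)
  also have "\<dots> \<le> v \<bullet> ((s *\<^sub>R mat 1 + A) *v v)"
    using assms by (simp add: eq inner_add_right psd_matrix_def)
  also have "\<dots> \<le> norm v * norm ((s *\<^sub>R mat 1 + A) *v v)"
    by (rule norm_cauchy_schwarz)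
  finally show ?thesis using False by (simp add: mult.commute)
qed simp

lemma psd_shift_inverse:
  fixes A :: "real^'n^'n"
  assumes "psd_matrix A" "s > 0"
  shows "(s *\<^sub>R mat 1 + A) *v (matrix_inv (s *\<^sub>R mat 1 + A) *v v) = v"
proof -
  let ?B = "s *\<^sub>R mat 1 + A"
  have "u = 0" if "?B *v u = 0" for u
    using psd_shift_norm_ge[OF assms(1), of s u] that assms(2)
    by (simp add: mult_le_0_iff)
  then have "invertible ?B"
    by (simp add: invertible_left_inverse matrix_left_invertible_ker)
  then have "\<exists>B'. ?B ** B' = mat 1 \<and> B' ** ?B = mat 1" by (simp add: invertible_def)
  then have "?B ** matrix_inv ?B = mat 1"
    unfolding matrix_inv_def by (rule someI2_ex) simp
  then show ?thesis by (simp add: matrix_vector_mul_assoc)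
qed

lemma onorm_matrix_bound:
  fixes A :: "real^'n^'m"
  assumes "onorm ((*v) A) \<le> b"
  shows "norm (A *v v) \<le> b * norm v"
  using onorm[OF matrix_vector_mul_bounded_linear[of A], of v]
    mult_right_mono[OF assms norm_ge_zero[of v]] by linarith

section \<open>Sharp-peak penalties\<close>

text \<open>
  Fermat's rule for the sum of \<open>h\<close> and a quadratic is used in this form: at a minimiser, \<open>h\<close>
  has a quadratic minorant whose slope there is a proximal, hence a limiting, subgradient.
\<close>

lemma quadratic_minorant_imp_limiting_subgradient:
  fixes h :: "real \<Rightarrow> ereal"
  assumes fin: "\<bar>h t\<bar> \<noteq> \<infinity>"
    and minor: "\<forall>\<^sub>F s in nhds t. h s \<ge> h t + ereal (\<nu> * (s - t) - C * (s - t)\<^sup>2)"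
  shows "\<nu> \<in> limiting_subdifferential h t"
proof -
  obtain r where r: "h t = ereal r" using fin by (cases "h t") auto
  have lim: "((\<lambda>s. ereal (- (C * \<bar>s - t\<bar>))) \<longlongrightarrow> ereal 0) (at t)"
    by (intro tendsto_intros tendsto_eq_intros) auto
  have le: "\<forall>\<^sub>F s in at t. ereal (- (C * \<bar>s - t\<bar>)) \<le>
      (h s - h t - ereal (\<nu> \<bullet> (s - t))) / ereal (norm (s - t))"
    using minor[THEN filter_leD[OF at_within_le_nhds[of t UNIV]]] eventually_neq_at_within[of t t]
  proof eventually_elim
    case (elim s)
    have pos: "norm (s - t) > 0" using elim by simp
    show ?case
    proof (cases "h s")
      case (real q)
      have "q - r - \<nu> * (s - t) \<ge> - (C * \<bar>s - t\<bar>) * \<bar>s - t\<bar>"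
        using elim(1) by (simp add: r real power2_eq_square algebra_simps)
      then have "- (C * \<bar>s - t\<bar>) \<le> (q - r - \<nu> * (s - t)) / \<bar>s - t\<bar>"
        using pos by (simp add: pos_le_divide_eq)
      then show ?thesis using pos by (simp add: r real)
    next
      case PInf
      then show ?thesis using pos by (simp add: r)
    next
      case MInf
      then show ?thesis using elim(1) by (simp add: r)
    qed
  qed
  have "0 = Liminf (at t) (\<lambda>s. ereal (- (C * \<bar>s - t\<bar>)))"
    using lim by (intro lim_imp_Liminf[symmetric]) (auto simp: zero_ereal_def)
  also have "\<dots> \<le> Liminf (at t) (\<lambda>s. (h s - h t - ereal (\<nu> \<bullet> (s - t))) / ereal (norm (s - t)))"
    using le by (rule Liminf_mono)
  finally have "\<nu> \<in> regular_subdifferential h t"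
    using fin by (simp add: regular_subdifferential_def)
  then show ?thesis using fin unfolding limiting_subdifferential_def
    by (intro CollectI conjI exI[of _ "\<lambda>_. t"] exI[of _ "\<lambda>_. \<nu>"]) auto
qed

lemma binary_subset_cube: "binary_points \<subseteq> (unit_cube :: (real^'n) set)"
proof
  fix u :: "real^'n" assume u: "u \<in> binary_points"
  have "u $ i \<in> {0..1}" for i
  proof -
    have "u $ i = 0 \<or> u $ i = 1" using u by (simp add: binary_points_def)
    then show ?thesis by auto
  qed
  then show "u \<in> unit_cube" by (simp add: unit_cube_def)
qed

lemma cube_diameter:
  assumes "u \<in> (unit_cube :: (real^'n) set)" "v \<in> unit_cube"
  shows "norm (u - v) \<le> sqrt (real CARD('n))"
proof -
  have "(\<Sum>i\<in>UNIV. ((u - v) $ i)\<^sup>2) \<le> (\<Sum>i\<in>(UNIV :: 'n set). 1)"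
  proof (rule sum_mono)
    fix i
    have "0 \<le> u $ i" "u $ i \<le> 1" "0 \<le> v $ i" "v $ i \<le> 1"
      using assms by (simp_all add: unit_cube_def)
    then have "\<bar>(u - v) $ i\<bar> \<le> 1" by (simp add: abs_le_iff)
    then show "((u - v) $ i)\<^sup>2 \<le> 1" by (simp add: abs_square_le_1)
  qed
  then show ?thesis by (simp add: norm_vec_def L2_set_def)
qed

lemma compact_cube: "compact (unit_cube :: (real^'n) set)"
proof -
  have "unit_cube = cbox (0 :: real^'n) 1"
    by (auto simp: unit_cube_def cbox_def Basis_vec_def inner_axis)
  then show ?thesis by (metis compact_cbox)
qed

lemma binary_points_separated:
  assumes "u \<in> (binary_points :: (real^'n) set)" "v \<in> binary_points" "norm (u - v) < 1"
  shows "u = v"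
proof (rule ccontr)
  assume "u \<noteq> v"
  then obtain i where "u $ i \<noteq> v $ i" by (auto simp: vec_eq_iff)
  moreover have "u $ i = 0 \<or> u $ i = 1" "v $ i = 0 \<or> v $ i = 1"
    using assms(1,2) by (auto simp: binary_points_def)
  ultimately have "\<bar>(u - v) $ i\<bar> = 1" by auto
  then show False using component_le_norm_cart[of "u - v" i] assms(3) by simp
qed

lemma penalty_nonneg:
  assumes "sharp_peak g c" "u \<in> unit_cube"
  shows "penalty g u \<ge> 0"
  using assms unfolding penalty_def sharp_peak_def unit_cube_def by (auto intro!: sum_nonneg)

lemma penalty_binary:
  assumes "sharp_peak g c" "u \<in> binary_points"
  shows "penalty g u = 0"
proof -
  have "g (u $ i) = 0" for i
  proof -
    have u: "u $ i \<in> {0, 1}" using assms(2) by (simp add: binary_points_def)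
    then have "u $ i \<in> {0..1}" by auto
    then show ?thesis using u assms(1) unfolding sharp_peak_def by blast
  qed
  then show ?thesis by (simp add: penalty_def)
qed

text \<open>
  The origin is binary and lies in the cube, so it is a competitor with finite objective.
\<close>

lemma subproblem_minimiser_penalty_finite:
  assumes sp: "sharp_peak g c" and m: "m > 0"
    and min: "is_arg_min (subproblem_objective g \<sigma> m xk yk) (\<lambda>u. u \<in> unit_cube) v"
  shows "\<bar>penalty g v\<bar> \<noteq> \<infinity>"
proof -
  have v: "v \<in> unit_cube" using min by (simp add: is_arg_min_def)
  have z: "0 \<in> (binary_points :: (real^'n) set)" by (simp add: binary_points_def)
  have "\<not> subproblem_objective g \<sigma> m xk yk 0 < subproblem_objective g \<sigma> m xk yk v"
    using min z binary_subset_cube by (auto simp: is_arg_min_def)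
  then have "penalty g v \<noteq> \<infinity>"
    using m by (auto simp: subproblem_objective_def penalty_binary[OF sp z])
  moreover have "penalty g v \<noteq> -\<infinity>" using penalty_nonneg[OF sp v] by auto
  ultimately show ?thesis by auto
qed

text \<open>
  The subproblem separates over the coordinates, so moving only coordinate \<open>i\<close> of the minimiser is
  an admissible comparison. It shows that
  \<open>(yk $ i + \<sigma> * (xk $ i - v $ i)) / m\<close> is a subgradient of \<open>g\<close> at the interior point \<open>v $ i\<close>, where
  the normal cone of the interval is trivial; a sharp-peak function has no subgradients smaller than \<open>c\<close>.
\<close>

lemma subproblem_minimiser_interior_coordinate:
  fixes v xk yk :: "real^'n"
  assumes sp: "sharp_peak g c" and m: "m > 0"
    and min: "is_arg_min (subproblem_objective g \<sigma> m xk yk) (\<lambda>u. u \<in> unit_cube) v"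
    and int: "0 < v $ i" "v $ i < 1"
  shows "m * c \<le> \<bar>yk $ i + \<sigma> * (xk $ i - v $ i)\<bar>"
proof -
  have v: "v \<in> unit_cube" using min by (simp add: is_arg_min_def)
  have gn: "g (v $ j) \<ge> 0" for j using sp v by (auto simp: sharp_peak_def unit_cube_def)
  have "\<bar>penalty g v\<bar> \<noteq> \<infinity>" by (rule subproblem_minimiser_penalty_finite[OF sp m min])
  then have fin: "\<bar>g (v $ j)\<bar> \<noteq> \<infinity>" for j
    unfolding penalty_def sum_Inf by auto
  define R where "R = real_of_ereal (\<Sum>j\<in>UNIV - {i}. g (v $ j))"
  have "\<bar>\<Sum>j\<in>UNIV - {i}. g (v $ j)\<bar> \<noteq> \<infinity>" using fin by (subst sum_Inf) auto
  then have R: "(\<Sum>j\<in>UNIV - {i}. g (v $ j)) = ereal R"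
    by (simp add: R_def ereal_real')
  define e where "e t = v + (t - v $ i) *\<^sub>R axis i 1" for t :: real
  have ei: "e t $ i = t" and ej: "j \<noteq> i \<Longrightarrow> e t $ j = v $ j" for t j
    by (auto simp: e_def axis_def)
  have ev: "e (v $ i) = v" by (simp add: e_def)
  have pen: "penalty g (e t) = g t + ereal R" for t
  proof -
    have "penalty g (e t) = g (e t $ i) + (\<Sum>j\<in>UNIV - {i}. g (e t $ j))"
      unfolding penalty_def by (subst sum.remove[of _ i]) auto
    also have "(\<Sum>j\<in>UNIV - {i}. g (e t $ j)) = (\<Sum>j\<in>UNIV - {i}. g (v $ j))"
      by (intro sum.cong) (auto simp: ej)
    finally show ?thesis by (simp add: ei R)
  qed
  define q where "q t = yk \<bullet> (xk - e t) + \<sigma> / 2 * (norm (xk - e t))\<^sup>2" for t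
  define \<nu> where "\<nu> = (yk $ i + \<sigma> * (xk $ i - v $ i)) / m"
  have qdiff: "q t = q (v $ i) - m * \<nu> * (t - v $ i) + \<sigma> / 2 * (t - v $ i)\<^sup>2" for t
  proof -
    define a where "a = xk - v"
    define s where "s = t - v $ i"
    have xe: "xk - e t = a - s *\<^sub>R axis i 1" by (simp add: e_def a_def s_def)
    have n: "(norm (a - s *\<^sub>R axis i 1))\<^sup>2 = (norm a)\<^sup>2 - 2 * s * a $ i + s\<^sup>2"
      unfolding power2_norm_eq_inner
      by (simp add: inner_diff_left inner_diff_right inner_axis inner_axis' power2_eq_square
          algebra_simps)
    have "m * \<nu> = yk $ i + \<sigma> * a $ i" using m by (simp add: \<nu>_def a_def)
    then show ?thesis
      unfolding q_def xe n ev a_def[symmetric] s_def[symmetric]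
      by (simp add: inner_diff_right inner_axis algebra_simps)
  qed
  obtain r where r: "g (v $ i) = ereal r" using fin[of i] by (cases "g (v $ i)") auto
  have minor: "g t \<ge> g (v $ i) + ereal (\<nu> * (t - v $ i) - \<sigma> / (2 * m) * (t - v $ i)\<^sup>2)"
    if t: "0 < t" "t < 1" for t
  proof -
    have "e t \<in> unit_cube" unfolding unit_cube_def
    proof (intro CollectI allI)
      fix j show "e t $ j \<in> {0..1}"
        using t v by (cases "j = i") (auto simp: ei ej unit_cube_def)
    qed
    then have ineq: "subproblem_objective g \<sigma> m xk yk v \<le> subproblem_objective g \<sigma> m xk yk (e t)"
      using min by (auto simp: is_arg_min_def not_less)
    have ob: "subproblem_objective g \<sigma> m xk yk (e t) = ereal m * (g t + ereal R) + ereal (q t)" for t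
      by (simp add: subproblem_objective_def pen q_def)
    have "g t \<noteq> -\<infinity>" using sp by (simp add: sharp_peak_def)
    then consider "g t = \<infinity>" | p where "g t = ereal p" by (cases "g t") auto
    then show ?thesis
    proof cases
      case 2
      have "m * (r + R) + q (v $ i) \<le> m * (p + R) + q t"
        using ineq ob[of t] ob[of "v $ i"] by (simp add: ev r 2)
      then have "m * (r + \<nu> * (t - v $ i) - \<sigma> / (2 * m) * (t - v $ i)\<^sup>2) \<le> m * p"
        using m unfolding qdiff[of t] by (simp add: algebra_simps)
      then show ?thesis using m by (simp add: r 2)
    qed simp
  qed
  have "\<forall>\<^sub>F t in nhds (v $ i). t \<in> {0<..<1}"
    using int by (intro eventually_nhds_in_open) auto
  then have "\<nu> \<in> limiting_subdifferential g (v $ i)"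
    using minor by (intro quadratic_minorant_imp_limiting_subgradient[where h = g and C = "\<sigma> / (2 * m)", OF fin])
      (auto elim!: eventually_mono)
  then have "c \<le> \<bar>\<nu>\<bar>" using sp int by (auto simp: sharp_peak_def)
  then show ?thesis using m by (simp add: \<nu>_def abs_div_pos[symmetric] pos_le_divide_eq mult.commute)
qed

section \<open>Runs of the algorithm\<close>

text \<open>
  The objective is taken real-valued, since an everywhere differentiable extended-valued function is
  finite everywhere. The number \<open>fB\<close> may be any lower bound of it on the cube for which the equation for
  \<open>\<alpha>\<close> holds.
\<close>

locale shapeak_run =
  fixes F :: "real^'n \<Rightarrow> real" and grad :: "real^'n \<Rightarrow> real^'n"
    and g :: "real \<Rightarrow> ereal" and c :: real
    and \<sigma> \<eta> \<rho> \<epsilon> lam \<beta> \<alpha> fB :: real and k0 :: nat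
    and Q :: "nat \<Rightarrow> real^'n^'n"
    and w x y :: "nat \<Rightarrow> real^'n" and \<mu> :: "nat \<Rightarrow> real"
  assumes gderiv: "\<And>u. GDERIV F u :> grad u"
    and grad_cont: "continuous_on UNIV grad"
    and spf: "sharp_peak g c"
    and mu0_pos: "\<mu> 0 > 0"
    and sigma_pos: "\<sigma> > 0"
    and eta: "\<eta> \<ge> 1"
    and rho: "0 \<le> \<rho>" "\<rho> \<le> 1/6"
    and eps: "\<epsilon> > 0"
    and fB: "\<And>u. u \<in> unit_cube \<Longrightarrow> fB \<le> F u"
    and alpha_eq: "\<alpha> = (2 * F (w 0) - 2 * fB) / \<sigma>"
    and grad_lip: "\<beta>-lipschitz_on (region \<alpha>) grad"
    and sequence: "shapeak_sequence grad g \<sigma> \<eta> \<rho> \<epsilon> k0 Q w x y \<mu>"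
    and Q_psd: "\<And>k. k \<ge> 1 \<Longrightarrow> psd_matrix (Q k)"
    and Q_norm: "\<And>k. k \<ge> 1 \<Longrightarrow> onorm ((*v) (Q k)) \<le> lam"
    and lam: "0 \<le> lam" "8 * lam \<le> \<sigma>"
    and beta: "8 * \<beta> \<le> \<sigma>"
    and mu0: "\<mu> 0 > mu_bar grad c"
begin

definition gap :: "nat \<Rightarrow> real^'n" where
  "gap k = x k - w k"

definition pen :: "nat \<Rightarrow> real" where
  "pen k = real_of_ereal (penalty g (w k))"

text \<open>
  The augmented Lagrangian at step \<open>k\<close> carries the weight \<open>\<sigma> / 2\<close> on the squared gap; the additional \<open>\<sigma>\<close>
  turns it into a Lyapunov function, because the old gap and the step of \<open>x\<close> together pay for the new gap.
\<close>

definition energy :: "nat \<Rightarrow> real" where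
  "energy k = F (x k) + \<mu> k * pen k + y k \<bullet> gap k + 3 * \<sigma> / 2 * (norm (gap k))\<^sup>2"

lemma w0_binary: "w 0 \<in> binary_points" and w0_eq: "w 0 = x 0" and y0_eq: "y 0 = - grad (w 0)"
  using sequence by (simp_all add: shapeak_sequence_def)

lemma w_argmin:
  "is_arg_min (subproblem_objective g \<sigma> (\<mu> k) (x k) (y k)) (\<lambda>u. u \<in> unit_cube) (w (Suc k))"
  using sequence by (simp add: shapeak_sequence_def)

lemma x_Suc: "x (Suc k) = w (Suc k) -
    matrix_inv (\<sigma> *\<^sub>R mat 1 + Q (Suc k)) *v (grad (w (Suc k)) + y k)"
  and y_Suc: "y (Suc k) = y k + \<sigma> *\<^sub>R gap (Suc k)"
  using sequence by (simp_all add: shapeak_sequence_def gap_def)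

lemma mu_Suc: "\<mu> (Suc k) =
    (if k0 dvd Suc k \<and> penalty g (w (Suc k)) \<noteq> 0
     then \<mu> k + min ((\<eta> - 1) * \<mu> k) (\<rho> * \<sigma> * (norm (gap (Suc k)))\<^sup>2 / (pen (Suc k) + \<epsilon>))
     else \<mu> k)"
proof -
  have "\<forall>k\<ge>1. \<mu> k =
        (if k0 dvd k \<and> penalty g (w k) \<noteq> 0
         then \<mu> (k - 1) + min ((\<eta> - 1) * \<mu> (k - 1))
                (\<rho> * \<sigma> * (norm (x k - w k))\<^sup>2 / (real_of_ereal (penalty g (w k)) + \<epsilon>))
         else \<mu> (k - 1))"
    using sequence by (simp add: shapeak_sequence_def)
  from this[rule_format, of "Suc k"] show ?thesis by (simp add: gap_def pen_def)
qed

lemma w_cube: "w k \<in> unit_cube"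
proof (cases k)
  case 0
  then show ?thesis using w0_binary binary_subset_cube by auto
next
  case (Suc j)
  then show ?thesis using w_argmin[of j] by (simp add: is_arg_min_def)
qed

lemma pen_nonneg: "pen k \<ge> 0"
  unfolding pen_def using penalty_nonneg[OF spf w_cube] by (rule real_of_ereal_pos)

lemma mu_le_Suc: "\<mu> k > 0 \<Longrightarrow> \<mu> k \<le> \<mu> (Suc k)"
  unfolding mu_Suc using eta rho sigma_pos eps pen_nonneg[of "Suc k"] by simp

lemma mu_ge: "\<mu> 0 \<le> \<mu> k"
proof (induction k)
  case (Suc k)
  then show ?case using mu_le_Suc[of k] mu0_pos by linarith
qed simp

lemma mu_pos: "\<mu> k > 0"
  using mu_ge[of k] mu0_pos by linarith

lemma penalty_w: "penalty g (w k) = ereal (pen k)"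
proof (cases k)
  case 0
  then show ?thesis using penalty_binary[OF spf w0_binary] by (simp add: pen_def)
next
  case (Suc j)
  have "\<bar>penalty g (w k)\<bar> \<noteq> \<infinity>"
    unfolding Suc by (rule subproblem_minimiser_penalty_finite[OF spf mu_pos w_argmin])
  then show ?thesis by (simp add: pen_def ereal_real')
qed

text \<open>
  The update of \<open>\<mu>\<close> divides by the penalty, so its cost in the Lagrangian is controlled by the gap
  alone, whatever the size of the penalty.
\<close>

lemma mu_increase_cost: "(\<mu> (Suc k) - \<mu> k) * pen (Suc k) \<le> \<sigma> / 6 * (norm (gap (Suc k)))\<^sup>2"
proof (cases "k0 dvd Suc k \<and> penalty g (w (Suc k)) \<noteq> 0")
  case True
  let ?p = "pen (Suc k)" and ?n = "(norm (gap (Suc k)))\<^sup>2"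
  have p: "?p \<ge> 0" by (rule pen_nonneg)
  have "(\<mu> (Suc k) - \<mu> k) * ?p \<le> \<rho> * \<sigma> * ?n / (?p + \<epsilon>) * ?p"
    using True p unfolding mu_Suc by (intro mult_right_mono) auto
  also have "\<dots> = \<rho> * \<sigma> * ?n * (?p / (?p + \<epsilon>))" by simp
  also have "\<dots> \<le> \<rho> * \<sigma> * ?n"
    using p eps rho sigma_pos by (intro mult_left_le) (auto simp: divide_le_eq)
  also have "\<dots> \<le> 1/6 * \<sigma> * ?n"
    using rho sigma_pos by (intro mult_right_mono) auto
  finally show ?thesis by simp
next
  case False
  then show ?thesis using sigma_pos unfolding mu_Suc by auto
qed

section \<open>The recursion for the gap\<close>

lemma gap_0: "gap 0 = 0"
  by (simp add: gap_def w0_eq)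

lemma Q_gap_norm: "norm (Q k *v gap k) \<le> lam * norm (gap k)"
proof (cases "k = 0")
  case False
  then show ?thesis using Q_norm[of k] by (intro onorm_matrix_bound) auto
qed (simp add: gap_0)

lemma shifted_Q_gap:
  "(\<sigma> *\<^sub>R mat 1 + Q (Suc k)) *v gap (Suc k) = - (grad (w (Suc k)) + y k)"
proof -
  have "gap (Suc k) = - (matrix_inv (\<sigma> *\<^sub>R mat 1 + Q (Suc k)) *v (grad (w (Suc k)) + y k))"
    by (simp add: gap_def x_Suc)
  also have "(\<sigma> *\<^sub>R mat 1 + Q (Suc k)) *v \<dots> = - (grad (w (Suc k)) + y k)"
    using psd_shift_inverse[OF Q_psd[of "Suc k"] sigma_pos, of "grad (w (Suc k)) + y k"]
    by (simp only: linear_neg[OF matrix_vector_mul_linear])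
  finally show ?thesis .
qed

text \<open>
  The updates of \<open>x\<close> and \<open>y\<close> share the linear system with the shifted matrix, and the \<open>\<sigma>\<close>-part cancels.
  At \<open>k = 0\<close> the gap vanishes, so the initial multiplier has the same form.
\<close>

lemma y_eq: "y k = - grad (w k) - Q k *v gap k"
proof (cases k)
  case 0
  then show ?thesis by (simp add: y0_eq gap_0)
next
  case (Suc j)
  have "\<sigma> *\<^sub>R gap (Suc j) + Q (Suc j) *v gap (Suc j) = - (grad (w (Suc j)) + y j)"
    using shifted_Q_gap[of j]
    by (simp add: matrix_vector_mult_add_rdistrib scaleR_matrix_vector_assoc[symmetric])
  then have "\<sigma> *\<^sub>R gap (Suc j) = - (grad (w (Suc j)) + y j) - Q (Suc j) *v gap (Suc j)"
    by (simp add: eq_diff_eq)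
  then show ?thesis unfolding Suc y_Suc by simp
qed

lemma beta_nonneg: "0 \<le> \<beta>"
  using grad_lip by (rule lipschitz_on_nonneg)

lemma alpha_nonneg: "0 \<le> \<alpha>"
  using fB[OF w_cube[of 0]] sigma_pos by (simp add: alpha_eq)

text \<open>
  The radius \<open>(sqrt n + sqrt \<alpha>) / 8\<close> is the bound on the gap that \<open>gap_Suc_le\<close> yields from
  \<open>\<parallel>d\<^sub>k\<parallel> \<le> sqrt \<alpha>\<close> and the diameter \<open>sqrt n\<close> of the cube.
\<close>

lemma near_cube_in_region:
  assumes u: "u \<in> unit_cube"
    and "norm (v - u) \<le> (sqrt (real CARD('n)) + sqrt \<alpha>) / 8"
  shows "v \<in> (region \<alpha> :: (real^'n) set)"
proof -
  have "infnorm u \<le> 1"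
    using u unfolding infnorm_cart unit_cube_def by (intro cSup_least) auto
  moreover have "infnorm v \<le> infnorm u + infnorm (v - u)"
    using infnorm_triangle[of u "v - u"] by simp
  ultimately show ?thesis
    using assms(2) infnorm_le_norm[of "v - u"] unfolding region_def mem_Collect_eq by linarith
qed

lemma convex_region: "convex (region \<alpha> :: (real^'n) set)"
proof (rule convexI)
  fix p q :: "real^'n" and s t :: real
  assume pq: "p \<in> region \<alpha>" "q \<in> region \<alpha>" and st: "0 \<le> s" "0 \<le> t" "s + t = 1"
  let ?r = "1 + (sqrt (real CARD('n)) + sqrt \<alpha>) / 8"
  have "infnorm (s *\<^sub>R p + t *\<^sub>R q) \<le> s * infnorm p + t * infnorm q"
    using infnorm_triangle[of "s *\<^sub>R p" "t *\<^sub>R q"] st by (simp add: infnorm_mul)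
  also have "\<dots> \<le> s * ?r + t * ?r"
    using pq st by (intro add_mono mult_left_mono) (auto simp: region_def)
  also have "\<dots> = ?r" using st by (simp flip: distrib_right)
  finally show "s *\<^sub>R p + t *\<^sub>R q \<in> region \<alpha>" by (simp add: region_def)
qed

lemma cube_in_region: "u \<in> unit_cube \<Longrightarrow> u \<in> (region \<alpha> :: (real^'n) set)"
  using alpha_nonneg by (intro near_cube_in_region[of u]) auto

text \<open>
  The change of the multiplier is a difference of gradients at two points of the cube plus
  \<open>Q\<close>-terms. Keeping the new \<open>Q\<close>-term on the left, inside the positive semidefinite shift, avoids
  losing a factor \<open>1 - lam / \<sigma>\<close>; with that loss the resulting bound would exceed the radius of the region.
\<close>

lemma gap_Suc_le:
  "\<sigma> * norm (gap (Suc k)) \<le> \<beta> * norm (w (Suc k) - w k) + lam * norm (gap k)"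
proof -
  have "\<sigma> * norm (gap (Suc k)) \<le> norm ((\<sigma> *\<^sub>R mat 1 + Q (Suc k)) *v gap (Suc k))"
    by (rule psd_shift_norm_ge[OF Q_psd]) simp
  also have "(\<sigma> *\<^sub>R mat 1 + Q (Suc k)) *v gap (Suc k) =
      (grad (w k) - grad (w (Suc k))) + Q k *v gap k"
    unfolding shifted_Q_gap y_eq[of k] by simp
  also have "norm \<dots> \<le> norm (grad (w k) - grad (w (Suc k))) + norm (Q k *v gap k)"
    by (rule norm_triangle_ineq)
  also have "norm (grad (w k) - grad (w (Suc k))) \<le> \<beta> * norm (w (Suc k) - w k)"
    using lipschitz_onD[OF grad_lip cube_in_region[OF w_cube] cube_in_region[OF w_cube], of "Suc k" k]
    by (simp add: dist_norm norm_minus_commute)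
  finally show ?thesis using Q_gap_norm[of k] by linarith
qed

lemma w_step_norm: "norm (w (Suc k) - w k) \<le> norm (x (Suc k) - x k) + norm (gap (Suc k)) + norm (gap k)"
proof -
  have "w (Suc k) - w k = (x (Suc k) - x k) - gap (Suc k) + gap k" by (simp add: gap_def)
  then show ?thesis
    using norm_triangle_ineq[of "(x (Suc k) - x k) - gap (Suc k)" "gap k"]
      norm_triangle_ineq4[of "x (Suc k) - x k" "gap (Suc k)"] by simp
qed

text \<open>
  The descent controls the step of \<open>x\<close> but not directly that of \<open>w\<close>, so the latter is eliminated.
\<close>

lemma gap_Suc_le_step:
  "7 * norm (gap (Suc k)) \<le> norm (x (Suc k) - x k) + 2 * norm (gap k)"
proof -
  let ?s = "norm (x (Suc k) - x k)" and ?e = "norm (gap k)" and ?e' = "norm (gap (Suc k))"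
  have "\<beta> * norm (w (Suc k) - w k) \<le> \<sigma> / 8 * (?s + ?e' + ?e)"
    using w_step_norm[of k] beta sigma_pos by (intro mult_mono) auto
  moreover have "lam * ?e \<le> \<sigma> / 8 * ?e" using lam by (intro mult_right_mono) auto
  ultimately have "\<sigma> * ?e' \<le> \<sigma> * ((?s + ?e' + ?e) / 8 + ?e / 8)"
    using gap_Suc_le[of k] by (simp add: field_simps)
  then have "?e' \<le> (?s + ?e' + ?e) / 8 + ?e / 8" using sigma_pos by simp
  then show ?thesis by argo
qed

lemma gap_Suc_le_crude:
  assumes "norm (gap k) \<le> sqrt \<alpha>"
  shows "norm (gap (Suc k)) \<le> (sqrt (real CARD('n)) + sqrt \<alpha>) / 8"
proof -
  let ?n = "sqrt (real CARD('n))"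
  have "\<beta> * norm (w (Suc k) - w k) \<le> \<sigma> / 8 * ?n"
    using cube_diameter[OF w_cube w_cube] beta sigma_pos by (intro mult_mono) auto
  moreover have "lam * norm (gap k) \<le> \<sigma> / 8 * sqrt \<alpha>"
    using lam assms sigma_pos by (intro mult_mono) auto
  ultimately have "\<sigma> * norm (gap (Suc k)) \<le> \<sigma> * ((?n + sqrt \<alpha>) / 8)"
    using gap_Suc_le[of k] by (simp add: algebra_simps)
  then show ?thesis using sigma_pos by simp
qed

section \<open>Decrease of the energy\<close>

text \<open>
  The first-order terms at \<open>w k\<close> cancel against the multiplier by \<open>y_eq\<close>; the remainders are at most
  \<open>(\<beta> + lam) \<parallel>d\<^sub>k\<parallel>\<^sup>2 \<le> \<sigma>/4 \<parallel>d\<^sub>k\<parallel>\<^sup>2\<close>, which the weight \<open>3 \<sigma> / 2\<close> absorbs.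
\<close>

lemma energy_lower_bound:
  assumes "x k \<in> region \<alpha>"
  shows "fB + \<sigma> * (norm (gap k))\<^sup>2 \<le> energy k"
proof -
  let ?n2 = "(norm (gap k))\<^sup>2"
  have "F (w k) + grad (w k) \<bullet> gap k - \<beta> * ?n2 \<le> F (x k)"
    using gradient_lower_bound[OF gderiv convex_region cube_in_region[OF w_cube] assms grad_lip]
    by (simp add: gap_def)
  moreover have "y k \<bullet> gap k = - (grad (w k) \<bullet> gap k) - (Q k *v gap k) \<bullet> gap k"
    by (subst y_eq) (simp add: inner_diff_left)
  moreover have "(Q k *v gap k) \<bullet> gap k \<le> lam * ?n2"
  proof -
    have "(Q k *v gap k) \<bullet> gap k \<le> norm (Q k *v gap k) * norm (gap k)"
      by (rule norm_cauchy_schwarz)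
    also have "\<dots> \<le> lam * norm (gap k) * norm (gap k)"
      using Q_gap_norm by (rule mult_right_mono) simp
    finally show ?thesis by (simp add: power2_eq_square mult.assoc)
  qed
  moreover have "0 \<le> \<mu> k * pen k" using mu_pos[of k] pen_nonneg[of k] by simp
  moreover have "\<beta> * ?n2 \<le> \<sigma> / 8 * ?n2" using beta by (intro mult_right_mono) auto
  moreover have "lam * ?n2 \<le> \<sigma> / 8 * ?n2" using lam by (intro mult_right_mono) auto
  moreover have "0 \<le> \<sigma> * ?n2" using sigma_pos by simp
  ultimately show ?thesis
    using fB[OF w_cube[of k]] unfolding energy_def by linarith
qed

lemma energy_0: "energy 0 = F (w 0)"
  by (simp add: energy_def gap_0 pen_def penalty_binary[OF spf w0_binary] w0_eq[symmetric])

lemma w_step_descent: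
  "\<mu> k * pen (Suc k) + y k \<bullet> (x k - w (Suc k)) + \<sigma> / 2 * (norm (x k - w (Suc k)))\<^sup>2
    \<le> \<mu> k * pen k + y k \<bullet> gap k + \<sigma> / 2 * (norm (gap k))\<^sup>2"
  using w_argmin[of k] w_cube[of k]
  by (auto simp: is_arg_min_def not_less subproblem_objective_def penalty_w gap_def add.assoc)

text \<open>
  As a function of \<open>x\<close>, the augmented Lagrangian is strongly convex up to the error \<open>\<beta> \<le> \<sigma> / 8\<close>, with
  \<open>3 \<sigma> / 8 = \<sigma> / 2 - \<sigma> / 8\<close>. The new point is not its exact minimiser: the gradient \<open>r\<close> there compares
  the true gradient with its value at \<open>w (Suc k)\<close> and with the model matrix, which costs at most
  \<open>(\<beta> + lam) \<parallel>d\<^sub>k\<^sub>+\<^sub>1\<parallel> \<le> \<sigma>/4 \<parallel>d\<^sub>k\<^sub>+\<^sub>1\<parallel>\<close>.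
\<close>

lemma x_step_descent:
  assumes "x k \<in> region \<alpha>" "x (Suc k) \<in> region \<alpha>"
  shows "F (x (Suc k)) + y k \<bullet> gap (Suc k) + \<sigma> / 2 * (norm (gap (Suc k)))\<^sup>2
    \<le> F (x k) + y k \<bullet> (x k - w (Suc k)) + \<sigma> / 2 * (norm (x k - w (Suc k)))\<^sup>2
      + \<sigma> / 4 * norm (gap (Suc k)) * norm (x (Suc k) - x k)
      - 3 * \<sigma> / 8 * (norm (x (Suc k) - x k))\<^sup>2"
proof -
  define s where "s = x (Suc k) - x k"
  define e where "e = gap (Suc k)"
  have xw: "x k - w (Suc k) = e - s" by (simp add: s_def e_def gap_def)
  have 1: "F (x (Suc k)) - grad (x (Suc k)) \<bullet> s - \<beta> * (norm s)\<^sup>2 \<le> F (x k)"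
    using gradient_lower_bound[OF gderiv convex_region assms(2,1) grad_lip]
    by (simp add: s_def inner_diff_right norm_minus_commute)
  have 2: "(norm (e - s))\<^sup>2 = (norm e)\<^sup>2 - 2 * (e \<bullet> s) + (norm s)\<^sup>2"
    unfolding power2_norm_eq_inner by (simp add: inner_diff_left inner_diff_right inner_commute)
  define r where "r = grad (x (Suc k)) + y k + \<sigma> *\<^sub>R e"
  have "r = (grad (x (Suc k)) - grad (w (Suc k))) - Q (Suc k) *v e"
  proof -
    have "r = grad (x (Suc k)) + y (Suc k)" by (simp add: r_def e_def y_Suc)
    then show ?thesis by (simp add: y_eq[of "Suc k"] e_def)
  qed
  then have "norm r \<le> norm (grad (x (Suc k)) - grad (w (Suc k))) + norm (Q (Suc k) *v e)"
    by (simp only: norm_triangle_ineq4)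
  also have "norm (grad (x (Suc k)) - grad (w (Suc k))) \<le> \<beta> * norm e"
    using lipschitz_onD[OF grad_lip assms(2) cube_in_region[OF w_cube]]
    by (simp add: dist_norm e_def gap_def)
  also have "\<beta> * norm e \<le> \<sigma> / 8 * norm e" using beta by (intro mult_right_mono) auto
  also have "norm (Q (Suc k) *v e) \<le> lam * norm e" unfolding e_def by (rule Q_gap_norm)
  also have "lam * norm e \<le> \<sigma> / 8 * norm e" using lam by (intro mult_right_mono) auto
  finally have "norm r \<le> \<sigma> / 4 * norm e" by simp
  then have "norm r * norm s \<le> \<sigma> / 4 * norm e * norm s" by (rule mult_right_mono) simp
  then have 3: "r \<bullet> s \<le> \<sigma> / 4 * norm e * norm s" using norm_cauchy_schwarz[of r s] by linarith
  have 4: "r \<bullet> s = grad (x (Suc k)) \<bullet> s + y k \<bullet> s + \<sigma> * (e \<bullet> s)"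
    by (simp add: r_def inner_add_left)
  have 5: "\<beta> * (norm s)\<^sup>2 \<le> \<sigma> / 8 * (norm s)\<^sup>2" using beta by (intro mult_right_mono) auto
  have 6: "\<sigma> / 2 * (norm (e - s))\<^sup>2 = \<sigma> / 2 * (norm e)\<^sup>2 - \<sigma> * (e \<bullet> s) + \<sigma> / 2 * (norm s)\<^sup>2"
    unfolding 2 by (simp add: algebra_simps)
  show ?thesis
    using 1 3 4 5 6 unfolding xw s_def[symmetric] e_def[symmetric] inner_diff_right by linarith
qed

text \<open>
  In units of \<open>\<sigma>\<close>, with \<open>s\<close> the step of \<open>x\<close> and \<open>e\<close>, \<open>e'\<close> the old and new gap, the change of energy is
  at most \<open>- e\<^sup>2 - 3/8 s\<^sup>2 + e' s / 4 + (1/6 + 1 + 1) e'\<^sup>2\<close>. Here \<open>1/6\<close> is the penalty update, one \<open>1\<close> the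
  multiplier update and the other the additional weight in the energy. Since
  \<open>49 e'\<^sup>2 \<le> 2 s\<^sup>2 + 8 e\<^sup>2\<close>, the negative terms win.
\<close>

lemma energy_descent:
  assumes "x k \<in> region \<alpha>" "x (Suc k) \<in> region \<alpha>"
  shows "energy (Suc k) + \<sigma> / 8 * (norm (x (Suc k) - x k))\<^sup>2 + \<sigma> / 2 * (norm (gap k))\<^sup>2 \<le> energy k"
proof -
  define s e e' where "s = norm (x (Suc k) - x k)" and "e = norm (gap k)" and "e' = norm (gap (Suc k))"
  have "energy (Suc k) = F (x (Suc k)) + \<mu> k * pen (Suc k) + (\<mu> (Suc k) - \<mu> k) * pen (Suc k)
      + y k \<bullet> gap (Suc k) + 5 * \<sigma> / 2 * e'\<^sup>2"
    unfolding energy_def y_Suc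
    by (simp add: inner_add_left power2_norm_eq_inner[symmetric] e'_def algebra_simps)
  then have main: "energy (Suc k) \<le> energy k - \<sigma> * e\<^sup>2 + \<sigma> / 4 * e' * s - 3 * \<sigma> / 8 * s\<^sup>2
      + \<sigma> / 6 * e'\<^sup>2 + 2 * \<sigma> * e'\<^sup>2"
    using w_step_descent[of k] x_step_descent[OF assms] mu_increase_cost[of k]
    unfolding energy_def s_def[symmetric] e_def[symmetric] e'_def[symmetric] by linarith
  have "(7 * e')\<^sup>2 \<le> (s + 2 * e)\<^sup>2"
    using gap_Suc_le_step[of k] by (intro power_mono) (auto simp: s_def e_def e'_def)
  moreover have "0 \<le> (s - 2 * e)\<^sup>2" by simp
  ultimately have "49 * e'\<^sup>2 \<le> 2 * s\<^sup>2 + 8 * e\<^sup>2"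
    by (simp add: power2_eq_square algebra_simps)
  moreover have "0 \<le> (e' - s)\<^sup>2" by simp
  then have "2 * e' * s \<le> e'\<^sup>2 + s\<^sup>2" by (simp add: power2_eq_square algebra_simps)
  moreover have "0 \<le> s\<^sup>2" "0 \<le> e\<^sup>2" by simp_all
  ultimately have "e' * s / 4 - 3 / 8 * s\<^sup>2 + e'\<^sup>2 / 6 + 2 * e'\<^sup>2 - e\<^sup>2 \<le> - (s\<^sup>2 / 8) - e\<^sup>2 / 2"
    by linarith
  then have "\<sigma> * (e' * s / 4 - 3 / 8 * s\<^sup>2 + e'\<^sup>2 / 6 + 2 * e'\<^sup>2 - e\<^sup>2) \<le> \<sigma> * (- (s\<^sup>2 / 8) - e\<^sup>2 / 2)"
    using sigma_pos by (intro mult_left_mono) auto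
  then show ?thesis
    using main unfolding s_def[symmetric] e_def[symmetric] by (simp add: algebra_simps)
qed

text \<open>
  The three claims support one another: a small gap puts the next iterate into the region, there the energy
  decreases, and low energy gives a small gap again. By the definition of \<open>\<alpha>\<close>, the energy at the start
  exceeds \<open>fB\<close> by \<open>\<sigma> \<alpha> / 2\<close>.
\<close>

lemma iterates_stay:
  "x k \<in> region \<alpha> \<and> energy k \<le> F (w 0) \<and> norm (gap k) \<le> sqrt \<alpha>"
proof (induction k)
  case 0
  have "x 0 \<in> region \<alpha>" using cube_in_region[OF w_cube[of 0]] by (simp add: w0_eq)
  then show ?case using alpha_nonneg by (simp add: energy_0 gap_0)
next
  case (Suc k)
  have x: "x (Suc k) \<in> region \<alpha>"
    using gap_Suc_le_crude[of k] Suc by (intro near_cube_in_region[OF w_cube[of "Suc k"]])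
      (simp add: gap_def)
  have "0 \<le> \<sigma> / 8 * (norm (x (Suc k) - x k))\<^sup>2 + \<sigma> / 2 * (norm (gap k))\<^sup>2"
    using sigma_pos by simp
  then have E: "energy (Suc k) \<le> F (w 0)"
    using energy_descent[of k] x Suc by linarith
  have "F (w 0) - fB = \<sigma> * \<alpha> / 2" using sigma_pos by (simp add: alpha_eq)
  then have "\<sigma> * (norm (gap (Suc k)))\<^sup>2 \<le> \<sigma> * \<alpha> / 2"
    using energy_lower_bound[OF x] E by linarith
  also have "\<dots> \<le> \<sigma> * \<alpha>" using sigma_pos alpha_nonneg by simp
  finally have "(norm (gap (Suc k)))\<^sup>2 \<le> \<alpha>" using sigma_pos by simp
  then show ?case using x E by (simp add: real_le_rsqrt)
qed

lemma steps_tendsto_0: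
  "gap \<longlonglongrightarrow> 0" "(\<lambda>k. w (Suc k) - w k) \<longlonglongrightarrow> 0"
proof -
  have desc: "energy (Suc k) + \<sigma> / 8 * (norm (x (Suc k) - x k))\<^sup>2 + \<sigma> / 2 * (norm (gap k))\<^sup>2 \<le> energy k"
    for k using energy_descent iterates_stay by blast
  have nn: "0 \<le> \<sigma> / 8 * (norm (x (Suc k) - x k))\<^sup>2" "0 \<le> \<sigma> / 2 * (norm (gap k))\<^sup>2" for k
    using sigma_pos by simp_all
  have "decseq energy"
  proof (rule decseq_SucI)
    fix k show "energy (Suc k) \<le> energy k" using desc[of k] nn[of k] by linarith
  qed
  moreover have "fB \<le> energy k" for k
  proof -
    have "0 \<le> \<sigma> * (norm (gap k))\<^sup>2" using sigma_pos by simp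
    then show ?thesis using energy_lower_bound[of k] iterates_stay[of k] by linarith
  qed
  ultimately obtain L where L: "energy \<longlonglongrightarrow> L" using decseq_convergent[of energy fB] by blast
  have diff: "(\<lambda>k. energy k - energy (Suc k)) \<longlonglongrightarrow> 0"
    using tendsto_diff[OF L LIMSEQ_Suc[OF L]] by simp
  have to0: "v \<longlonglongrightarrow> 0" if a: "a > 0" "\<And>k. a * (norm (v k))\<^sup>2 \<le> energy k - energy (Suc k)"
    for a and v :: "nat \<Rightarrow> real^'n"
  proof -
    have "(\<lambda>k. a * (norm (v k))\<^sup>2) \<longlonglongrightarrow> 0"
      using a by (intro tendsto_sandwich[OF _ _ tendsto_const diff]) (auto intro!: always_eventually)
    then have "(\<lambda>k. inverse a * (a * (norm (v k))\<^sup>2)) \<longlonglongrightarrow> inverse a * 0"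
      by (intro tendsto_mult tendsto_const)
    then have "(\<lambda>k. (norm (v k))\<^sup>2) \<longlonglongrightarrow> 0" using a(1) by (simp add: field_simps)
    then have "(\<lambda>k. sqrt ((norm (v k))\<^sup>2)) \<longlonglongrightarrow> sqrt 0" by (rule tendsto_real_sqrt)
    then show ?thesis by (simp add: tendsto_norm_zero_iff)
  qed
  show gap: "gap \<longlonglongrightarrow> 0"
  proof (rule to0)
    show "\<sigma> / 2 > 0" using sigma_pos by simp
    show "\<sigma> / 2 * (norm (gap k))\<^sup>2 \<le> energy k - energy (Suc k)" for k
      using desc[of k] nn[of k] by linarith
  qed
  have step: "(\<lambda>k. x (Suc k) - x k) \<longlonglongrightarrow> 0"
  proof (rule to0)
    show "\<sigma> / 8 > 0" using sigma_pos by simp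
    show "\<sigma> / 8 * (norm (x (Suc k) - x k))\<^sup>2 \<le> energy k - energy (Suc k)" for k
      using desc[of k] nn[of k] by linarith
  qed
  have "(\<lambda>k. (x (Suc k) - x k) - gap (Suc k) + gap k) \<longlonglongrightarrow> 0 - 0 + 0"
    by (intro tendsto_intros step gap LIMSEQ_Suc)
  then show "(\<lambda>k. w (Suc k) - w k) \<longlonglongrightarrow> 0" by (simp add: gap_def)
qed

section \<open>Identification of a binary point\<close>

lemma c_pos: "c > 0"
  using spf by (simp add: sharp_peak_def)

lemma grad_component_bound:
  assumes "u \<in> unit_cube"
  shows "\<bar>grad u $ i\<bar> \<le> mu_bar grad c * c"
proof -
  have "\<bar>grad u $ i\<bar> \<le> infnorm (grad u)" by (rule component_le_infnorm_cart)
  also have "\<dots> \<le> (SUP v\<in>unit_cube. infnorm (grad v))"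
  proof (rule cSUP_upper[OF assms])
    have "continuous_on unit_cube (\<lambda>v. infnorm (grad v))"
      using grad_cont by (intro continuous_on_infnorm) (auto intro: continuous_on_subset)
    then have "compact ((\<lambda>v. infnorm (grad v)) ` unit_cube)"
      by (rule compact_continuous_image[OF _ compact_cube])
    then show "bdd_above ((\<lambda>v. infnorm (grad v)) ` unit_cube)"
      by (intro bounded_imp_bdd_above compact_imp_bounded)
  qed
  also have "\<dots> = mu_bar grad c * c" using c_pos by (simp add: mu_bar_def)
  finally show ?thesis .
qed

text \<open>
  Here \<open>b k\<close> bounds the distance of \<open>y k + \<sigma> (x k - w (Suc k))\<close> from \<open>- grad (w k)\<close>. Once it is below
  \<open>(\<mu> 0 - mu_bar grad c) c\<close>, the optimality condition at an interior coordinate cannot hold.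
\<close>

lemma eventually_w_binary: "\<forall>\<^sub>F k in sequentially. w (Suc k) \<in> binary_points"
proof -
  define b where "b k = (lam + \<sigma>) * norm (gap k) + \<sigma> * norm (w (Suc k) - w k)" for k
  have "b \<longlonglongrightarrow> (lam + \<sigma>) * norm (0 :: real^'n) + \<sigma> * norm (0 :: real^'n)"
    unfolding b_def by (intro tendsto_intros steps_tendsto_0)
  then have "b \<longlonglongrightarrow> 0" by simp
  moreover have "(\<mu> 0 - mu_bar grad c) * c > 0" using mu0 c_pos by simp
  ultimately have "\<forall>\<^sub>F k in sequentially. b k < (\<mu> 0 - mu_bar grad c) * c"
    by (rule order_tendstoD)
  then show ?thesis
  proof eventually_elim
    case (elim k)
    show ?case
    proof (rule ccontr)
      assume "w (Suc k) \<notin> binary_points"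
      then obtain i where "w (Suc k) $ i \<noteq> 0" "w (Suc k) $ i \<noteq> 1"
        by (auto simp: binary_points_def)
      moreover have "w (Suc k) $ i \<in> {0..1}" using w_cube[of "Suc k"] by (simp add: unit_cube_def)
      ultimately have "0 < w (Suc k) $ i" "w (Suc k) $ i < 1" by auto
      then have low: "\<mu> k * c \<le> \<bar>y k $ i + \<sigma> * (x k $ i - w (Suc k) $ i)\<bar>"
        by (rule subproblem_minimiser_interior_coordinate[OF spf mu_pos w_argmin])
      define r where "r = - (Q k *v gap k) + \<sigma> *\<^sub>R gap k - \<sigma> *\<^sub>R (w (Suc k) - w k)"
      have "y k + \<sigma> *\<^sub>R (x k - w (Suc k)) = - grad (w k) + r"
        by (subst y_eq) (simp add: r_def gap_def algebra_simps)
      from arg_cong[OF this, of "\<lambda>v. v $ i"]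
      have "y k $ i + \<sigma> * (x k $ i - w (Suc k) $ i) = - grad (w k) $ i + r $ i" by simp
      then have "\<bar>y k $ i + \<sigma> * (x k $ i - w (Suc k) $ i)\<bar> \<le> \<bar>grad (w k) $ i\<bar> + \<bar>r $ i\<bar>"
        by simp
      moreover have "\<bar>r $ i\<bar> \<le> b k"
      proof -
        have "norm r \<le> norm (Q k *v gap k) + norm (\<sigma> *\<^sub>R gap k) + norm (\<sigma> *\<^sub>R (w (Suc k) - w k))"
          unfolding r_def
          using norm_triangle_ineq4[of "- (Q k *v gap k) + \<sigma> *\<^sub>R gap k" "\<sigma> *\<^sub>R (w (Suc k) - w k)"]
            norm_triangle_ineq[of "- (Q k *v gap k)" "\<sigma> *\<^sub>R gap k"] by simp
        also have "\<dots> = norm (Q k *v gap k) + \<sigma> * norm (gap k) + \<sigma> * norm (w (Suc k) - w k)"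
          using sigma_pos by simp
        also have "\<dots> \<le> b k"
          using Q_gap_norm[of k] by (simp add: b_def distrib_right)
        finally show ?thesis using component_le_norm_cart[of r i] by linarith
      qed
      moreover have "\<mu> 0 * c \<le> \<mu> k * c" using mu_ge c_pos by simp
      ultimately show False
        using low grad_component_bound[OF w_cube[of k], of i] elim by (simp add: algebra_simps)
    qed
  qed
qed

lemma eventually_w_constant:
  "\<exists>N b. b \<in> binary_points \<and> (\<forall>k\<ge>N. w k = b)"
proof -
  have "\<forall>\<^sub>F k in sequentially. norm (w (Suc k) - w k) < 1"
    using tendsto_norm[OF steps_tendsto_0(2)] by (auto dest: order_tendstoD(2)[of _ _ _ 1])
  moreover have "\<forall>\<^sub>F k in sequentially. w k \<in> binary_points"
    using eventually_w_binary by (simp add: eventually_sequentially_Suc[of "\<lambda>k. w k \<in> binary_points"])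
  ultimately have "\<forall>\<^sub>F k in sequentially. w (Suc k) = w k \<and> w k \<in> binary_points"
    using eventually_w_binary by eventually_elim (auto intro: binary_points_separated)
  then obtain N where N: "\<And>k. k \<ge> N \<Longrightarrow> w (Suc k) = w k" "w N \<in> binary_points"
    by (auto simp: eventually_sequentially)
  have "w k = w N" if "k \<ge> N" for k
    using that by (induction k rule: dec_induct) (simp_all add: N(1))
  then show ?thesis using N(2) by blast
qed

lemma gap_geometric_decay:
  assumes const: "\<And>k. k \<ge> N \<Longrightarrow> w k = b"
  shows "norm (gap (N + j)) \<le> sqrt \<alpha> * (lam / (\<sigma> - lam)) ^ j"
proof (induction j)
  case 0
  then show ?case using iterates_stay by simp
next
  case (Suc j)
  have sl: "\<sigma> - lam > 0" using lam sigma_pos by linarith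
  have "\<sigma> * norm (gap (N + Suc j)) \<le> lam * norm (gap (N + j))"
    using gap_Suc_le[of "N + j"] by (simp add: const)
  moreover have "(\<sigma> - lam) * norm (gap (N + Suc j)) \<le> \<sigma> * norm (gap (N + Suc j))"
    using lam by (intro mult_right_mono) auto
  ultimately have "norm (gap (N + Suc j)) \<le> lam / (\<sigma> - lam) * norm (gap (N + j))"
    using sl by (simp add: pos_le_divide_eq mult.commute)
  also have "\<dots> \<le> lam / (\<sigma> - lam) * (sqrt \<alpha> * (lam / (\<sigma> - lam)) ^ j)"
    using Suc lam sl by (intro mult_left_mono) auto
  finally show ?case by (simp add: mult_ac)
qed

end

section \<open>Convergence and termination\<close>

text \<open>
  A delay \<open>m\<close> independent of the tolerance serves two purposes. The logarithm may be negative, but for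
  tolerances below \<open>1\<close> it is at least \<open>log \<gamma> (1 / a)\<close>, so a fixed \<open>m\<close> makes the index positive. And
  one extra factor \<open>\<gamma>\<close> turns \<open>a * \<gamma> ^ j \<le> tol\<close> into the strict inequality of the stopping test. For
  \<open>a = 0\<close> the logarithm is \<open>log \<gamma> 0 = 0\<close> by convention.
\<close>

lemma log_stopping_index:
  fixes \<gamma> a :: real
  assumes \<gamma>: "0 < \<gamma>" "\<gamma> < 1" and a: "0 \<le> a"
  obtains m :: nat where "m > 0"
    and "\<And>tol. 0 < tol \<Longrightarrow> tol < 1 \<Longrightarrow> 1 \<le> int m + \<lceil>log \<gamma> (tol / a)\<rceil>"
    and "\<And>tol j. 0 < tol \<Longrightarrow> tol < 1 \<Longrightarrow> int m + \<lceil>log \<gamma> (tol / a)\<rceil> \<le> int j \<Longrightarrow> a * \<gamma> ^ j < tol"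
proof (cases "a = 0")
  case True
  then show thesis by (intro that[of 1]) (auto simp: log_def)
next
  case False
  then have a: "a > 0" using a by simp
  define m where "m = nat (max 1 (1 - \<lceil>log \<gamma> (1 / a)\<rceil>))"
  have m: "int m \<ge> 1" "int m \<ge> 1 - \<lceil>log \<gamma> (1 / a)\<rceil>" unfolding m_def by linarith+
  show thesis
  proof
    show "m > 0" using m by simp
    fix tol :: real assume tol: "0 < tol" "tol < 1"
    have "log \<gamma> (1 / a) \<le> log \<gamma> (tol / a)"
      using \<gamma> a tol by (simp add: log_def divide_right_mono_neg divide_right_mono)
    then have "\<lceil>log \<gamma> (1 / a)\<rceil> \<le> \<lceil>log \<gamma> (tol / a)\<rceil>" by (rule ceiling_mono)
    then show "1 \<le> int m + \<lceil>log \<gamma> (tol / a)\<rceil>" using m by linarith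
    fix j :: nat assume "int m + \<lceil>log \<gamma> (tol / a)\<rceil> \<le> int j"
    then have "1 + log \<gamma> (tol / a) \<le> real j" using m by linarith
    then have "\<gamma> powr real j \<le> \<gamma> powr (1 + log \<gamma> (tol / a))"
      using \<gamma> by (intro powr_mono') auto
    also have "\<dots> = \<gamma> * (tol / a)" using \<gamma> a tol by (simp add: powr_add)
    also have "\<dots> < 1 * (tol / a)" using \<gamma> a tol by (intro mult_strict_right_mono) auto
    finally show "a * \<gamma> ^ j < tol" using \<gamma> a by (simp add: powr_realpow field_simps)
  qed
qed

theorem theorem4p2:
  fixes f :: "real^'n \<Rightarrow> ereal" and grad :: "real^'n \<Rightarrow> real^'n"
    and g :: "real \<Rightarrow> ereal" and c :: real
    and \<sigma> \<eta> \<rho> \<epsilon> lam \<beta> \<alpha> \<gamma> :: real and k0 :: nat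
    and Q :: "nat \<Rightarrow> real^'n^'n"
    and w x y :: "nat \<Rightarrow> real^'n" and \<mu> :: "nat \<Rightarrow> real"
  assumes f_C1: "continuously_differentiable_ext f grad"
    and g_spf: "sharp_peak g c"
    and params: "\<mu> 0 > 0" "\<sigma> > 0" "\<eta> > 1" "0 < \<rho>" "\<rho> \<le> 1/6" "\<epsilon> > 0" "k0 > 0"
    and alpha_eq: "\<alpha> = alpha f (w 0) \<sigma>"
    and local_lip: "locally_lipschitz_on (region \<alpha> :: (real^'n) set) grad"
    and beta: "\<beta> > 0" "\<beta>-lipschitz_on (region \<alpha>) grad"
    and lam: "lam > 0"
    and sequence: "shapeak_sequence grad g \<sigma> \<eta> \<rho> \<epsilon> k0 Q w x y \<mu>"
    and Q: "\<And>k. k \<ge> 1 \<Longrightarrow> psd_matrix (Q k)" "\<And>k. k \<ge> 1 \<Longrightarrow> onorm ((*v) (Q k)) \<le> lam"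
    and sigma: "\<sigma> \<ge> 8 * max lam \<beta>"
    and mu0: "\<mu> 0 > mu_bar grad c"
    and gamma_eq: "\<gamma> = lam / (\<sigma> - lam)"
  shows "\<gamma> > 0 \<and> \<gamma> \<le> 1/7 \<and>
    (\<exists>xinf. x \<longlonglongrightarrow> xinf \<and>
      (\<exists>\<kappa>>0.
        (\<forall>k\<ge>\<kappa>. w (Suc k) = w k \<and> w k = xinf \<and> xinf \<in> binary_points \<and>
                norm (x k - xinf) \<le> sqrt \<alpha> * \<gamma> ^ (k - \<kappa>) \<and>
                norm (y k + grad xinf) \<le> sqrt \<alpha> * lam * \<gamma> ^ (k - \<kappa>)) \<and>
        (\<forall>tol. 0 < tol \<and> tol < 1 \<longrightarrow>
          (\<forall>k. int k \<ge> int \<kappa> + \<lceil>log \<gamma> (tol / (max 1 lam * sqrt \<alpha>))\<rceil> \<longrightarrow>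
                stopping_test grad tol (w k) (x k) (y k)))))"
proof -
  have \<gamma>: "0 < \<gamma>" "\<gamma> \<le> 1 / 7"
    using lam sigma by (auto simp: gamma_eq divide_simps)
  define F where "F u = real_of_ereal (f u)" for u
  have f_eq: "f u = ereal (F u)" for u
    using f_C1 eventually_nhds_x_imp_x[of "\<lambda>u. \<bar>f u\<bar> \<noteq> \<infinity>" u]
    by (simp add: continuously_differentiable_ext_def has_gradient_ext_def F_def ereal_real')
  have gderiv: "GDERIV F u :> grad u" for u
    using f_C1 by (simp add: continuously_differentiable_ext_def has_gradient_ext_def F_def[abs_def])
  define fB where "fB = real_of_ereal (INF u\<in>unit_cube. f u)"
  have fB: "fB \<le> F u" if u: "u \<in> unit_cube" for u
  proof -
    have "continuous_on unit_cube F"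
      using gderiv by (intro continuous_at_imp_continuous_on ballI)
        (auto simp: gderiv_def intro: has_derivative_continuous)
    then obtain v where v: "v \<in> unit_cube" "\<And>z. z \<in> unit_cube \<Longrightarrow> F v \<le> F z"
      using continuous_attains_inf[OF compact_cube, of F] u by auto
    then have "(INF z\<in>unit_cube. f z) = f v"
      by (intro antisym INF_lower INF_greatest) (auto simp: f_eq)
    then show ?thesis using v(2)[OF u] by (simp add: fB_def f_eq)
  qed
  interpret shapeak_run F grad g c \<sigma> \<eta> \<rho> \<epsilon> lam \<beta> \<alpha> fB k0 Q w x y \<mu>
  proof
    show "continuous_on UNIV grad" using f_C1 by (simp add: continuously_differentiable_ext_def)
    show "\<alpha> = (2 * F (w 0) - 2 * fB) / \<sigma>" by (simp add: alpha_eq alpha_def F_def fB_def)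
  qed (use gderiv fB g_spf params beta lam sequence Q sigma mu0 in auto)
  obtain N b where b: "b \<in> binary_points" "\<And>k. k \<ge> N \<Longrightarrow> w k = b"
    using eventually_w_constant by blast
  have decay: "norm (gap k) \<le> sqrt \<alpha> * \<gamma> ^ (k - K)" if "K \<ge> N" "k \<ge> K" for k K
    using gap_geometric_decay[of K b "k - K"] that b(2) by (simp add: gamma_eq)
  have residual: "norm (y k + grad (w k)) \<le> lam * norm (gap k)" for k
    using Q_gap_norm[of k] by (simp add: y_eq[of k])
  define a where "a = max 1 lam * sqrt \<alpha>"
  have a: "0 \<le> a" "sqrt \<alpha> \<le> a" "lam * sqrt \<alpha> \<le> a"
    using alpha_nonneg by (simp_all add: a_def mult_right_mono mult_le_cancel_right1)
  obtain m where m: "m > 0"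
    "\<And>tol. 0 < tol \<Longrightarrow> tol < 1 \<Longrightarrow> 1 \<le> int m + \<lceil>log \<gamma> (tol / a)\<rceil>"
    "\<And>tol j. 0 < tol \<Longrightarrow> tol < 1 \<Longrightarrow> int m + \<lceil>log \<gamma> (tol / a)\<rceil> \<le> int j \<Longrightarrow> a * \<gamma> ^ j < tol"
    by (rule log_stopping_index[of \<gamma> a]) (use \<gamma> a(1) in auto)
  \<comment> \<open>The rates hold from \<open>N\<close> on; the later start \<open>\<kappa>\<close> leaves room for the stopping index.\<close>
  define \<kappa> where "\<kappa> = N + m"
  have "x \<longlonglongrightarrow> b"
  proof -
    have "(\<lambda>k. gap k + b) \<longlonglongrightarrow> 0 + b" by (intro tendsto_intros steps_tendsto_0)
    moreover have "\<forall>\<^sub>F k in sequentially. gap k + b = x k"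
      using b(2) by (auto simp: gap_def eventually_sequentially)
    ultimately show ?thesis by (auto dest: Lim_transform_eventually)
  qed
  moreover have "w (Suc k) = w k \<and> w k = b \<and> b \<in> binary_points \<and>
      norm (x k - b) \<le> sqrt \<alpha> * \<gamma> ^ (k - \<kappa>) \<and>
      norm (y k + grad b) \<le> sqrt \<alpha> * lam * \<gamma> ^ (k - \<kappa>)" if k: "k \<ge> \<kappa>" for k
  proof -
    have wk: "w k = b" "w (Suc k) = b" using k b(2) by (simp_all add: \<kappa>_def)
    have d: "norm (gap k) \<le> sqrt \<alpha> * \<gamma> ^ (k - \<kappa>)" using k by (intro decay) (simp_all add: \<kappa>_def)
    have "norm (y k + grad b) \<le> lam * norm (gap k)" using residual[of k] by (simp add: wk)
    also have "\<dots> \<le> lam * (sqrt \<alpha> * \<gamma> ^ (k - \<kappa>))" using d lam by (intro mult_left_mono) auto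
    finally show ?thesis using d wk b(1) by (simp add: gap_def mult_ac)
  qed
  moreover have "stopping_test grad tol (w k) (x k) (y k)"
    if tol: "0 < tol" "tol < 1" and k: "int k \<ge> int \<kappa> + \<lceil>log \<gamma> (tol / a)\<rceil>" for tol k
  proof -
    have kN: "k \<ge> N" using k m(2)[OF tol] by (simp add: \<kappa>_def)
    have small: "a * \<gamma> ^ (k - N) < tol"
      using k kN by (intro m(3)[OF tol]) (simp add: \<kappa>_def)
    have d: "norm (gap k) \<le> sqrt \<alpha> * \<gamma> ^ (k - N)" using kN by (intro decay) auto
    also have "\<dots> \<le> a * \<gamma> ^ (k - N)" using a \<gamma> by (intro mult_right_mono) auto
    finally have 1: "norm (x k - w k) < tol" using small by (simp add: gap_def)
    have "norm (y k + grad (w k)) \<le> lam * norm (gap k)" by (rule residual)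
    also have "\<dots> \<le> lam * (sqrt \<alpha> * \<gamma> ^ (k - N))" using d lam by (intro mult_left_mono) auto
    also have "\<dots> = (lam * sqrt \<alpha>) * \<gamma> ^ (k - N)" by simp
    also have "\<dots> \<le> a * \<gamma> ^ (k - N)" using a \<gamma> by (intro mult_right_mono) auto
    finally have 2: "norm (y k + grad (w k)) < tol" using small by simp
    have scale: "t / (1 + norm (w k)) < tol" if "0 \<le> t" "t < tol" for t
    proof -
      have "t / (1 + norm (w k)) \<le> t / 1" using that by (intro divide_left_mono) (auto intro: add_pos_nonneg)
      then show ?thesis using that by simp
    qed
    show ?thesis
      using scale[OF norm_ge_zero 1] scale[OF norm_ge_zero 2] b kN by (simp add: stopping_test_def)
  qed
  moreover have "\<kappa> > 0" using m(1) by (simp add: \<kappa>_def)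
  ultimately show ?thesis using \<gamma> unfolding a_def[symmetric] by blast
qed

end
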